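(* Let $K$ be a finite field with $q$ elements and let $\Psi(x)\in K[x]$ be a polynomial of degree $\deg\Psi\geqslant 1$. Then there exists an irreducible polynomial in $K[x]$ that is coprime to $\Psi$ and has degree $\leqslant \log_q(\deg\Psi)+1$.
   Context: $\log_q$ denotes the logarithm to base $q$. *)

theory Defs
  imports "HOL-Computational_Algebra.Computational_Algebra" "HOL-Library.Cardinality"
begin

end

theory Submission
  imports Defs
begin

text \<open>
  Counting monic polynomials of degree \<open>m\<close> by their factorisations into powers of monic
  irreducibles yields Gauss's formula \<open>\<Sum>{deg p | p monic irreducible, deg p dvd k} = q ^ k\<close>.
  If every irreducible polynomial of degree at most \<open>k\<close> divided \<open>\<Psi>\<close>, all monic irreducibles of
  degree dividing \<open>k\<close> would be distinct prime factors of \<open>\<Psi>\<close>, forcing \<open>q ^ k \<le> deg \<Psi>\<close>.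
  Taking \<open>k = \<lfloor>log\<^sub>q (deg \<Psi>)\<rfloor> + 1\<close> makes this impossible.
\<close>

definition monic_polys :: "nat \<Rightarrow> 'a::comm_semiring_1 poly set" where
  "monic_polys m = {f. lead_coeff f = 1 \<and> degree f = m}"

lemma monic_polys_0: "monic_polys 0 = {1}"
  by (auto simp: monic_polys_def elim: degree_eq_zeroE)

lemma monic_polys_Suc:
  "monic_polys (Suc m) = (\<lambda>(a, g). pCons a g) ` (UNIV \<times> monic_polys m)"
proof (intro equalityI subsetI)
  fix f :: "'a poly" assume "f \<in> monic_polys (Suc m)"
  moreover obtain a g where "f = pCons a g" by (cases f)
  ultimately show "f \<in> (\<lambda>(a, g). pCons a g) ` (UNIV \<times> monic_polys m)"
    by (cases "g = 0") (auto simp: monic_polys_def)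
qed (auto simp: monic_polys_def)

lemma finite_monic_polys: "finite (monic_polys m :: 'a::{comm_semiring_1,finite} poly set)"
  by (induction m) (simp_all add: monic_polys_0 monic_polys_Suc)

lemma card_monic_polys: "card (monic_polys m :: 'a::{comm_semiring_1,finite} poly set) = CARD('a) ^ m"
proof (induction m)
  case (Suc m)
  have "inj_on (\<lambda>(a, g). pCons a g) (UNIV \<times> (monic_polys m :: 'a poly set))"
    by (auto simp: inj_on_def)
  with Suc show ?case
    by (simp add: monic_polys_Suc card_image card_cartesian_product)
qed (simp add: monic_polys_0)

lemma monic_mult_in_monic_polys_iff:
  fixes g :: "'a::idom poly"
  assumes "lead_coeff g = 1" "degree g \<le> m"
  shows "g * h \<in> monic_polys m \<longleftrightarrow> h \<in> monic_polys (m - degree g)"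
proof (cases "h = 0")
  case False
  have "g \<noteq> 0" using assms(1) by auto
  have "lead_coeff (g * h) = lead_coeff h"
    using assms(1) by (simp only: lead_coeff_mult mult_1)
  moreover have "degree (g * h) = degree g + degree h"
    using \<open>g \<noteq> 0\<close> False by (rule degree_mult_eq)
  ultimately show ?thesis
    using assms(2) by (auto simp: monic_polys_def)
qed (simp add: monic_polys_def)

lemma card_monic_polys_dvd:
  fixes g :: "'a::{idom,finite} poly"
  assumes "lead_coeff g = 1" "degree g \<le> m"
  shows "card {f \<in> monic_polys m. g dvd f} = CARD('a) ^ (m - degree g)"
proof -
  have "g \<noteq> 0" using assms(1) by auto
  have "{f \<in> monic_polys m. g dvd f} = (\<lambda>h. g * h) ` monic_polys (m - degree g)"
    using monic_mult_in_monic_polys_iff[OF assms] by (auto simp: dvd_def)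
  moreover have "inj_on (\<lambda>h. g * h) (monic_polys (m - degree g))"
    using \<open>g \<noteq> 0\<close> by (auto simp: inj_on_def)
  ultimately show ?thesis by (simp add: card_image card_monic_polys)
qed

lemma card_monic_polys_power_dvd:
  fixes p :: "'a::{idom,finite} poly"
  assumes "lead_coeff p = 1" "e * degree p \<le> m"
  shows "card {f \<in> monic_polys m. p ^ e dvd f} = CARD('a) ^ (m - e * degree p)"
proof -
  have "p \<noteq> 0" using assms(1) by auto
  have "lead_coeff (p ^ e) = 1"
    using assms(1) by (simp only: lead_coeff_power power_one)
  moreover have "degree (p ^ e) = e * degree p"
    using \<open>p \<noteq> 0\<close> by (rule degree_power_eq)
  ultimately show ?thesis
    using card_monic_polys_dvd[of "p ^ e" m] assms(2) by simp
qed

lemma finite_monic_polys_degree_le: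
  "finite {f :: 'a::{comm_semiring_1,finite} poly. lead_coeff f = 1 \<and> degree f \<le> m}"
proof (rule finite_subset)
  show "{f :: 'a poly. lead_coeff f = 1 \<and> degree f \<le> m} \<subseteq> (\<Union>j\<le>m. monic_polys j)"
    by (auto simp: monic_polys_def)
qed (simp add: finite_monic_polys)

lemma irreducible_not_dvd_imp_coprime:
  fixes p :: "'a::field poly"
  assumes "irreducible p" "\<not> p dvd f"
  shows "coprime p f"
proof (rule coprimeI)
  fix c assume "c dvd p" "c dvd f"
  with assms show "is_unit c"
    using irreducibleD' dvd_trans by blast
qed

lemma irreducible_imp_degree_pos:
  fixes p :: "'a::field poly"
  assumes "irreducible p"
  shows "degree p > 0"
  using assms is_unit_iff_degree[of p] by (auto simp: irreducible_def)

context
begin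

text \<open>
  \<open>Polynomial_Factorial\<close> makes this interpretation only inside a closed context, so it is
  repeated here; its normalised primes are the monic irreducible polynomials.
\<close>

interpretation field_poly:
  normalization_euclidean_semiring_multiplicative where zero = "0 :: 'a :: field poly"
    and one = 1 and plus = plus and minus = minus
    and times = times
    and normalize = "\<lambda>p. smult (inverse (lead_coeff p)) p"
    and unit_factor = "\<lambda>p. [:lead_coeff p:]"
    and euclidean_size = "\<lambda>p. if p = 0 then 0 else 2 ^ degree p"
    and divide = divide and modulo = modulo
  rewrites "dvd.dvd (times :: 'a poly \<Rightarrow> _) = Rings.dvd"
    and "comm_monoid_mult.prod_mset times 1 = prod_mset"
    and "comm_semiring_1.irreducible times 1 0 = irreducible"
    and "comm_semiring_1.prime_elem times 1 0 = prime_elem"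
    and "comm_monoid_mult.prod times 1 = prod"
    and "power.power 1 times = power"
proof -
  show "comm_monoid_mult.prod times 1 = prod"
    by (simp add: prod_dict)
  show "power.power 1 times = power"
    by (simp add: power_dict)
  show "dvd.dvd (times :: 'a poly \<Rightarrow> _) = Rings.dvd"
    by (simp add: dvd_dict)
  show "comm_monoid_mult.prod_mset times 1 = prod_mset"
    by (simp add: prod_mset_dict)
  show "comm_semiring_1.irreducible times 1 0 = irreducible"
    by (simp add: irreducible_dict)
  show "comm_semiring_1.prime_elem times 1 0 = prime_elem"
    by (simp add: prime_elem_dict)
  show "class.normalization_euclidean_semiring_multiplicative divide plus minus (0 :: 'a poly) times 1
    modulo (\<lambda>p. if p = 0 then 0 else 2 ^ degree p)
    (\<lambda>p. [:lead_coeff p:]) (\<lambda>p. smult (inverse (lead_coeff p)) p)"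
  proof (standard, fold dvd_dict)
    fix p :: "'a poly"
    show "[:lead_coeff p:] * smult (inverse (lead_coeff p)) p = p"
      by (cases "p = 0") simp_all
  next
    fix p :: "'a poly" assume "is_unit p"
    then show "[:lead_coeff p:] = p"
      by (elim is_unit_polyE) (auto simp: monom_0 one_poly_def field_simps)
  next
    fix p :: "'a poly" assume "p \<noteq> 0"
    then show "is_unit [:lead_coeff p:]"
      by (simp add: is_unit_pCons_iff)
  next
    fix a b :: "'a poly" assume "is_unit a"
    then show "[:lead_coeff (a * b):] = a * [:lead_coeff b:]"
      by (auto elim!: is_unit_polyE)
  qed (auto simp: lead_coeff_mult Rings.div_mult_mod_eq intro!: degree_mod_less' degree_mult_right_le)
qed

lemma field_poly_prime_iff:
  fixes p :: "'a::field poly"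
  shows "field_poly.prime p \<longleftrightarrow> irreducible p \<and> lead_coeff p = 1"
proof
  assume "field_poly.prime p"
  then have p: "prime_elem p" "smult (inverse (lead_coeff p)) p = p"
    by (simp_all add: field_poly.prime_def)
  then have "p \<noteq> 0" by auto
  have "lead_coeff p = lead_coeff (smult (inverse (lead_coeff p)) p)"
    using p(2) by simp
  also have "\<dots> = 1"
    using \<open>p \<noteq> 0\<close> by simp
  finally show "irreducible p \<and> lead_coeff p = 1"
    using p(1) by (simp add: prime_elem_imp_irreducible)
next
  assume "irreducible p \<and> lead_coeff p = 1"
  then show "field_poly.prime p"
    by (simp add: field_poly.prime_def field_poly_irreducible_imp_prime)
qed

lemma degree_eq_sum_multiplicity:
  fixes f :: "'a::field poly"
  assumes "f \<noteq> 0"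
  shows "degree f = (\<Sum>p\<in>field_poly.prime_factors f. field_poly.multiplicity p f * degree p)"
proof -
  have "degree f = degree (\<Prod>p\<in>field_poly.prime_factors f. p ^ field_poly.multiplicity p f)"
    using assms by (simp add: field_poly.prod_prime_factors)
  also have "\<dots> = (\<Sum>p\<in>field_poly.prime_factors f. field_poly.multiplicity p f * degree p)"
    by (subst degree_prod_sum_eq)
      (auto simp: field_poly.in_prime_factors_iff degree_power_eq intro!: sum.cong)
  finally show ?thesis .
qed

lemma degree_eq_sum_irreducible_power_divisors:
  fixes f :: "'a::field poly"
  assumes "f \<noteq> 0"
  shows "degree f = (\<Sum>(p, e) | irreducible p \<and> lead_coeff p = 1 \<and> 1 \<le> e \<and> p ^ e dvd f. degree p)"
proof -
  have "{(p, e). irreducible p \<and> lead_coeff p = 1 \<and> 1 \<le> e \<and> p ^ e dvd f}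
      = Sigma (field_poly.prime_factors f) (\<lambda>p. {1..field_poly.multiplicity p f})"
  proof safe
    fix p :: "'a poly" and e :: nat
    assume p: "irreducible p" "lead_coeff p = 1" and e: "1 \<le> e" "p ^ e dvd f"
    have "p dvd p ^ e"
      using e(1) by simp
    then have "p dvd f"
      using e(2) by (rule dvd_trans)
    with p show "p \<in> field_poly.prime_factors f"
      using assms by (simp add: field_poly.in_prime_factors_iff field_poly_prime_iff)
    show "e \<in> {1..field_poly.multiplicity p f}"
      using e assms p by (simp add: field_poly.power_dvd_iff_le_multiplicity irreducible_not_unit)
  next
    fix p :: "'a poly" and e :: nat
    assume p: "p \<in> field_poly.prime_factors f" and e: "e \<in> {1..field_poly.multiplicity p f}"
    then show "irreducible p" "lead_coeff p = 1"
      by (simp_all add: field_poly.in_prime_factors_iff field_poly_prime_iff)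
    then show "p ^ e dvd f"
      using e assms by (simp add: field_poly.power_dvd_iff_le_multiplicity irreducible_not_unit)
  qed auto
  then show ?thesis
    using assms by (simp add: sum.Sigma[symmetric] degree_eq_sum_multiplicity)
qed

lemma sum_degree_irreducible_divisors_le:
  fixes f :: "'a::field poly"
  assumes "f \<noteq> 0" and "\<And>p. p \<in> S \<Longrightarrow> irreducible p \<and> lead_coeff p = 1 \<and> p dvd f"
  shows "(\<Sum>p\<in>S. degree p) \<le> degree f"
proof -
  have "S \<subseteq> field_poly.prime_factors f"
    using assms by (auto simp: field_poly.in_prime_factors_iff field_poly_prime_iff)
  then have "(\<Sum>p\<in>S. degree p) \<le> (\<Sum>p\<in>field_poly.prime_factors f. degree p)"
    by (intro sum_mono2) auto
  also have "\<dots> \<le> (\<Sum>p\<in>field_poly.prime_factors f. field_poly.multiplicity p f * degree p)"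
    using assms(1) by (intro sum_mono) (simp add: field_poly.prime_factors_multiplicity)
  finally show ?thesis
    using assms(1) by (simp add: degree_eq_sum_multiplicity)
qed

end

definition irreducible_power_pairs :: "nat \<Rightarrow> ('a::comm_semiring_1 poly \<times> nat) set" where
  "irreducible_power_pairs m = {(p, e). irreducible p \<and> lead_coeff p = 1 \<and> 1 \<le> e \<and> e * degree p \<le> m}"

lemma finite_irreducible_power_pairs:
  "finite (irreducible_power_pairs m :: ('a::{field,finite} poly \<times> nat) set)"
proof (rule finite_subset)
  show "irreducible_power_pairs m
      \<subseteq> {p :: 'a poly. lead_coeff p = 1 \<and> degree p \<le> m} \<times> {1..m}"
  proof clarify
    fix p :: "'a poly" and e :: nat
    assume "(p, e) \<in> irreducible_power_pairs m"
    then have "irreducible p" "lead_coeff p = 1" "1 \<le> e" "e * degree p \<le> m"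
      by (simp_all add: irreducible_power_pairs_def)
    moreover have "1 \<le> degree p"
      using irreducible_imp_degree_pos[OF \<open>irreducible p\<close>] by simp
    ultimately show "p \<in> {p. lead_coeff p = 1 \<and> degree p \<le> m} \<and> e \<in> {1..m}"
      by (simp add: order_trans[OF _ \<open>e * degree p \<le> m\<close>])
  qed
qed (simp add: finite_monic_polys_degree_le)

lemma irreducible_power_divisors_eq:
  fixes f :: "'a::field poly"
  assumes "f \<in> monic_polys m"
  shows "{(p, e). irreducible p \<and> lead_coeff p = 1 \<and> 1 \<le> e \<and> p ^ e dvd f}
    = {(p, e) \<in> irreducible_power_pairs m. p ^ e dvd f}"
proof -
  have "e * degree p \<le> m" if "irreducible p" "p ^ e dvd f" for p :: "'a poly" and e
  proof -
    have "p \<noteq> 0" "f \<noteq> 0"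
      using that(1) assms by (auto simp: monic_polys_def)
    then show ?thesis
      using dvd_imp_degree_le[OF that(2)] assms by (simp add: degree_power_eq monic_polys_def)
  qed
  then show ?thesis
    by (auto simp: irreducible_power_pairs_def)
qed

text \<open>Counting pairs (monic polynomial \<open>f\<close> of degree \<open>m\<close>, prime power \<open>p ^ e\<close> dividing \<open>f\<close>),
  weighted by \<open>degree p\<close>, in two ways.\<close>

lemma sum_irreducible_power_pairs:
  "m * CARD('a::{field,finite}) ^ m
    = (\<Sum>(p, e)\<in>irreducible_power_pairs m. degree (p :: 'a poly) * CARD('a) ^ (m - e * degree p))"
proof -
  let ?q = "CARD('a)" and ?M = "monic_polys m :: 'a poly set"
  let ?P = "irreducible_power_pairs m :: ('a poly \<times> nat) set"
  have "m * ?q ^ m = (\<Sum>f\<in>?M. m)"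
    by (simp add: card_monic_polys)
  also have "\<dots> = (\<Sum>f\<in>?M. degree f)"
    by (rule sum.cong) (simp_all add: monic_polys_def)
  also have "\<dots> = (\<Sum>f\<in>?M. \<Sum>x\<in>?P. if fst x ^ snd x dvd f then degree (fst x) else 0)"
  proof (rule sum.cong)
    fix f assume f: "f \<in> ?M"
    then have "f \<noteq> 0" by (auto simp: monic_polys_def)
    then have "degree f = (\<Sum>(p, e) | irreducible p \<and> lead_coeff p = 1 \<and> 1 \<le> e \<and> p ^ e dvd f. degree p)"
      by (rule degree_eq_sum_irreducible_power_divisors)
    also have "\<dots> = (\<Sum>x\<in>{x \<in> ?P. fst x ^ snd x dvd f}. degree (fst x))"
      unfolding irreducible_power_divisors_eq[OF f] by (rule sum.cong) auto
    finally show "degree f = (\<Sum>x\<in>?P. if fst x ^ snd x dvd f then degree (fst x) else 0)"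
      by (simp add: sum.inter_filter finite_irreducible_power_pairs)
  qed simp
  also have "\<dots> = (\<Sum>x\<in>?P. \<Sum>f\<in>?M. if fst x ^ snd x dvd f then degree (fst x) else 0)"
    by (rule sum.swap)
  also have "\<dots> = (\<Sum>x\<in>?P. degree (fst x) * card {f \<in> ?M. fst x ^ snd x dvd f})"
    by (simp add: sum.inter_filter[symmetric] finite_monic_polys mult.commute)
  also have "\<dots> = (\<Sum>(p, e)\<in>?P. degree p * ?q ^ (m - e * degree p))"
    by (rule sum.cong) (auto simp: irreducible_power_pairs_def card_monic_polys_power_dvd)
  finally show ?thesis .
qed

lemma sum_degree_irreducible_powers_of_degree:
  "(\<Sum>(p, e) | irreducible p \<and> lead_coeff p = 1 \<and> 1 \<le> e \<and> e * degree p = Suc m. degree (p :: 'a poly))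
    = CARD('a::{field,finite}) ^ Suc m"
proof -
  let ?q = "CARD('a)" and ?P = "irreducible_power_pairs :: nat \<Rightarrow> ('a poly \<times> nat) set"
  let ?E = "{(p :: 'a poly, e). irreducible p \<and> lead_coeff p = 1 \<and> 1 \<le> e \<and> e * degree p = Suc m}"
  have split: "?P (Suc m) = ?P m \<union> ?E" and disjoint: "?P m \<inter> ?E = {}"
    by (auto simp: irreducible_power_pairs_def)
  have "?E \<subseteq> ?P (Suc m)"
    unfolding split by blast
  then have "finite ?E"
    using finite_irreducible_power_pairs by (rule finite_subset)
  have "Suc m * ?q ^ Suc m = (\<Sum>(p, e)\<in>?P (Suc m). degree p * ?q ^ (Suc m - e * degree p))"
    by (rule sum_irreducible_power_pairs)
  also have "\<dots> = (\<Sum>(p, e)\<in>?P m. degree p * ?q ^ (Suc m - e * degree p))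
      + (\<Sum>(p, e)\<in>?E. degree p * ?q ^ (Suc m - e * degree p))"
    unfolding split using \<open>finite ?E\<close> disjoint
    by (intro sum.union_disjoint) (simp_all add: finite_irreducible_power_pairs)
  also have "(\<Sum>(p, e)\<in>?P m. degree p * ?q ^ (Suc m - e * degree p)) = ?q * (m * ?q ^ m)"
    unfolding sum_irreducible_power_pairs sum_distrib_left
    by (rule sum.cong) (auto simp: irreducible_power_pairs_def Suc_diff_le)
  also have "(\<Sum>(p, e)\<in>?E. degree p * ?q ^ (Suc m - e * degree p)) = (\<Sum>(p, e)\<in>?E. degree p)"
    by (rule sum.cong) auto
  finally show ?thesis
    by (simp add: algebra_simps)
qed

lemma sum_degree_monic_irreducible_degree_dvd:
  assumes "k > 0"
  shows "(\<Sum>p | irreducible p \<and> lead_coeff p = 1 \<and> degree p dvd k. degree (p :: 'a poly))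
    = CARD('a::{field,finite}) ^ k"
proof -
  let ?S = "{p :: 'a poly. irreducible p \<and> lead_coeff p = 1 \<and> degree p dvd k}"
  let ?E = "{(p :: 'a poly, e). irreducible p \<and> lead_coeff p = 1 \<and> 1 \<le> e \<and> e * degree p = k}"
  have "inj_on fst ?E"
    by (rule inj_onI) (auto dest: irreducible_imp_degree_pos)
  have "fst ` ?E = ?S"
  proof (intro equalityI subsetI)
    fix p assume "p \<in> ?S"
    then obtain e where "k = degree p * e" by auto
    with \<open>p \<in> ?S\<close> assms show "p \<in> fst ` ?E"
      by (intro image_eqI[of p fst "(p, e)"]) (auto simp: mult.commute)
  qed auto
  then have "(\<Sum>p\<in>?S. degree p) = (\<Sum>(p, e)\<in>?E. degree p)"
    using sum.reindex[OF \<open>inj_on fst ?E\<close>, of degree] by (simp add: case_prod_beta)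
  also have "\<dots> = CARD('a) ^ k"
    using assms sum_degree_irreducible_powers_of_degree[of "k - 1", where 'a = 'a] by simp
  finally show ?thesis .
qed

lemma exists_irreducible_not_dvd:
  fixes f :: "'a::{field,finite} poly"
  assumes "f \<noteq> 0" "k > 0" "degree f < CARD('a) ^ k"
  shows "\<exists>p. irreducible p \<and> \<not> p dvd f \<and> degree p \<le> k"
proof (rule ccontr)
  assume nondivisor: "\<nexists>p. irreducible p \<and> \<not> p dvd f \<and> degree p \<le> k"
  have "(\<Sum>p | irreducible p \<and> lead_coeff p = 1 \<and> degree p dvd k. degree (p :: 'a poly))
      \<le> degree f"
  proof (rule sum_degree_irreducible_divisors_le[OF assms(1)])
    fix p :: "'a poly"
    assume "p \<in> {p. irreducible p \<and> lead_coeff p = 1 \<and> degree p dvd k}"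
    with nondivisor assms(2) show "irreducible p \<and> lead_coeff p = 1 \<and> p dvd f"
      by (auto dest: dvd_imp_le)
  qed
  with assms(2,3) show False
    by (simp add: sum_degree_monic_irreducible_degree_dvd)
qed

theorem lemma2:
  fixes Psi :: "'a::{field,finite} poly"
  assumes "degree Psi \<ge> 1"
  shows "\<exists>P :: 'a poly. irreducible P \<and> coprime P Psi \<and>
           real (degree P) \<le> log (real CARD('a)) (real (degree Psi)) + 1"
proof -
  let ?q = "CARD('a)"
  have "card {0 :: 'a, 1} \<le> ?q"
    by (rule card_mono) simp_all
  then have q: "?q \<ge> 2" by simp
  obtain n where n: "?q ^ n \<le> degree Psi" "degree Psi < ?q ^ (n + 1)"
    using ex_power_ivl1[OF q assms] by blast
  have "Psi \<noteq> 0" using assms by auto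
  then obtain P where P: "irreducible P" "\<not> P dvd Psi" "degree P \<le> n + 1"
    using exists_irreducible_not_dvd[of Psi "n + 1"] n(2) by auto
  have "real n \<le> log (real ?q) (real (degree Psi))"
    using n(1) q by (intro le_log_of_power) (simp_all flip: of_nat_power)
  with P(3) have "real (degree P) \<le> log (real ?q) (real (degree Psi)) + 1"
    by linarith
  with P show ?thesis
    by (blast intro: irreducible_not_dvd_imp_coprime)
qed

end
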